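(* Socle length $\mathbf{sx}$ satisfies the quotient and normal subgroup axioms on finite groups. That is, if $G\to H$ is a surjective homomorphism of finite groups, then $\mathbf{sx}(H)\le\mathbf{sx}(G)$; and if $N$ is a normal subgroup of a finite group $G$, then $\mathbf{sx}(N)\le\mathbf{sx}(G)$.
   Context: The socle $\mathrm{soc}(G)$ of a finite group $G$ is the subgroup generated by the minimal normal subgroups of $G$. The socle series is $V_0=\mathbf{1}$ and $V_{i+1}$ = the preimage of $\mathrm{soc}(G/V_i)$ under the quotient map $G\to G/V_i$; the socle length $\mathbf{sx}(G)$ is the least $\ell\ge 0$ with $V_\ell=G$. *)

theory Defs
  imports "HOL-Algebra.Algebra"
begin

definition minimal_normal :: "'a set \<Rightarrow> ('a, 'c) monoid_scheme \<Rightarrow> bool" where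
  "minimal_normal N G \<longleftrightarrow>
     N \<lhd> G \<and> N \<noteq> {\<one>\<^bsub>G\<^esub>} \<and> (\<forall>M. M \<lhd> G \<longrightarrow> M \<subseteq> N \<longrightarrow> M = {\<one>\<^bsub>G\<^esub>} \<or> M = N)"

definition socle :: "('a, 'c) monoid_scheme \<Rightarrow> 'a set" where
  "socle G = generate G (\<Union>{N. minimal_normal N G})"

text \<open>The quotient map from \<open>G\<close> to \<open>G Mod V\<close> sends \<open>x\<close> to the coset \<open>V #> x\<close>.\<close>

primrec socle_series :: "('a, 'c) monoid_scheme \<Rightarrow> nat \<Rightarrow> 'a set" where
  "socle_series G 0 = {\<one>\<^bsub>G\<^esub>}"
| "socle_series G (Suc i) =
     {x \<in> carrier G. socle_series G i #>\<^bsub>G\<^esub> x \<in> socle (G Mod socle_series G i)}"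

text \<open>The \<open>LEAST\<close> below is only meaningful when the series reaches \<open>carrier G\<close>;
  for finite \<open>G\<close> it does, see \<open>socle_series_socle_length\<close>.\<close>

definition socle_length :: "('a, 'c) monoid_scheme \<Rightarrow> nat" where
  "socle_length G = (LEAST l. socle_series G l = carrier G)"

lemma socle_normal:
  assumes "group G" shows "socle G \<lhd> G"
proof -
  interpret group G by fact
  have sub: "\<Union>{N. minimal_normal N G} \<subseteq> carrier G"
    by (auto simp: minimal_normal_def dest!: normal_imp_subgroup dest: subgroup.mem_carrier)
  show ?thesis
    unfolding socle_def
  proof (rule normal_generateI[OF sub])
    fix h g assume "h \<in> \<Union>{N. minimal_normal N G}" and g: "g \<in> carrier G"
    then obtain N where "minimal_normal N G" "h \<in> N" by blast
    then show "g \<otimes>\<^bsub>G\<^esub> h \<otimes>\<^bsub>G\<^esub> inv\<^bsub>G\<^esub> g \<in> \<Union>{N. minimal_normal N G}"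
      using normal.inv_op_closed2[of N G g h] g by (auto simp: minimal_normal_def)
  qed
qed

lemma minimal_normal_exists:
  assumes "group G" "finite (carrier G)" "carrier G \<noteq> {\<one>\<^bsub>G\<^esub>}"
  obtains N where "minimal_normal N G"
proof -
  let ?S = "{N. N \<lhd> G \<and> N \<noteq> {\<one>\<^bsub>G\<^esub>}}"
  have "?S \<subseteq> Pow (carrier G)"
    by (auto dest!: normal_imp_subgroup dest: subgroup.mem_carrier)
  then have "finite ?S"
    using assms(2) by (meson finite_Pow_iff finite_subset)
  moreover have "carrier G \<in> ?S"
    using assms by (auto intro!: group.normal_invI group.subgroup_self
        simp: group.is_monoid monoid.m_closed)
  ultimately obtain N where "N \<in> ?S" "\<forall>M\<in>?S. M \<subseteq> N \<longrightarrow> N = M"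
    using finite_has_minimal[of ?S] by blast
  then show thesis
    by (intro that[of N]) (auto simp: minimal_normal_def)
qed

lemma socle_nontrivial:
  assumes "group G" "finite (carrier G)" "carrier G \<noteq> {\<one>\<^bsub>G\<^esub>}"
  shows "socle G \<noteq> {\<one>\<^bsub>G\<^esub>}"
proof -
  obtain N where N: "minimal_normal N G" using minimal_normal_exists[OF assms] .
  then have "N \<subseteq> socle G" by (auto simp: socle_def intro: generate.incl)
  moreover have "\<one>\<^bsub>G\<^esub> \<in> N" "N \<noteq> {\<one>\<^bsub>G\<^esub>}"
    using N by (auto simp: minimal_normal_def dest: normal_imp_subgroup subgroup.one_closed)
  ultimately show ?thesis by blast
qed

lemma socle_series_normal:
  assumes "group G" shows "socle_series G i \<lhd> G"
proof (induction i)
  case 0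
  show ?case using group.one_is_normal[OF assms] by simp
next
  case (Suc i)
  interpret V: normal "socle_series G i" G by (fact Suc)
  let ?Q = "G Mod socle_series G i"
  have Q: "group ?Q" by (rule V.factorgroup_is_group)
  interpret S: normal "socle ?Q" ?Q by (rule socle_normal[OF Q])
  have hom: "(\<lambda>x. socle_series G i #>\<^bsub>G\<^esub> x) \<in> hom G ?Q" by (rule V.r_coset_hom_Mod)
  interpret h: group_hom G ?Q "\<lambda>x. socle_series G i #>\<^bsub>G\<^esub> x"
    using hom Q assms by (simp add: group_hom_def group_hom_axioms_def)
  have one: "socle_series G i #>\<^bsub>G\<^esub> \<one>\<^bsub>G\<^esub> = \<one>\<^bsub>?Q\<^esub>" using h.hom_one .
  show ?case
  proof (rule group.normal_invI[OF assms])
    show "subgroup (socle_series G (Suc i)) G"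
    proof (rule subgroup.intro)
      show "socle_series G (Suc i) \<subseteq> carrier G" by auto
      show "\<one>\<^bsub>G\<^esub> \<in> socle_series G (Suc i)" using one subgroup.one_closed[OF S.subgroup_axioms] by simp
      fix x assume x: "x \<in> socle_series G (Suc i)"
      then show "inv\<^bsub>G\<^esub> x \<in> socle_series G (Suc i)"
        using h.hom_inv[of x] subgroup.m_inv_closed[OF S.subgroup_axioms] by simp
      fix y assume "y \<in> socle_series G (Suc i)"
      with x show "x \<otimes>\<^bsub>G\<^esub> y \<in> socle_series G (Suc i)"
        using h.hom_mult[of x y] subgroup.m_closed[OF S.subgroup_axioms] by simp
    qed
    fix x g assume "x \<in> socle_series G (Suc i)" and g: "g \<in> carrier G"
    then have x: "x \<in> carrier G" "socle_series G i #>\<^bsub>G\<^esub> x \<in> socle ?Q" by auto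
    have "socle_series G i #>\<^bsub>G\<^esub> (g \<otimes>\<^bsub>G\<^esub> x \<otimes>\<^bsub>G\<^esub> inv\<^bsub>G\<^esub> g) \<in> socle ?Q"
      using S.inv_op_closed2[OF h.hom_closed[OF g] x(2)] g x(1)
        h.hom_mult[of g x] h.hom_mult[of "g \<otimes>\<^bsub>G\<^esub> x" "inv\<^bsub>G\<^esub> g"] h.hom_inv[OF g] by simp
    then show "g \<otimes>\<^bsub>G\<^esub> x \<otimes>\<^bsub>G\<^esub> inv\<^bsub>G\<^esub> g \<in> socle_series G (Suc i)" using g x(1) by simp
  qed
qed

lemma socle_series_psubset:
  assumes "group G" "finite (carrier G)" "socle_series G i \<noteq> carrier G"
  shows "socle_series G i \<subset> socle_series G (Suc i)"
proof -
  interpret V: normal "socle_series G i" G by (rule socle_series_normal[OF assms(1)])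
  let ?Q = "G Mod socle_series G i"
  have Q: "group ?Q" by (rule V.factorgroup_is_group)
  interpret S: normal "socle ?Q" ?Q by (rule socle_normal[OF Q])
  have one: "socle_series G i \<in> socle ?Q" using subgroup.one_closed[OF S.subgroup_axioms] by simp
  have "finite (carrier ?Q)" using assms(2) by (simp add: carrier_FactGroup)
  moreover have "carrier ?Q \<noteq> {\<one>\<^bsub>?Q\<^esub>}"
  proof
    assume eq: "carrier ?Q = {\<one>\<^bsub>?Q\<^esub>}"
    have "x \<in> socle_series G i" if x: "x \<in> carrier G" for x
      using eq x V.rcos_self[OF x V.is_subgroup] by (auto simp: carrier_FactGroup)
    then show False using assms(3) V.subset by blast
  qed
  ultimately obtain C where C: "C \<in> socle ?Q" "C \<noteq> socle_series G i"
    using socle_nontrivial[OF Q] one by force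
  then obtain x where x: "x \<in> carrier G" "C = socle_series G i #>\<^bsub>G\<^esub> x"
    using S.subset by (auto simp: carrier_FactGroup)
  have "x \<notin> socle_series G i" using C x V.rcos_const by auto
  moreover have "x \<in> socle_series G (Suc i)" using C x by simp
  moreover have "socle_series G i \<subseteq> socle_series G (Suc i)"
    using one V.rcos_const by auto
  ultimately show ?thesis by blast
qed

lemma socle_series_socle_length:
  assumes "group G" "finite (carrier G)"
  shows "socle_series G (socle_length G) = carrier G"
proof -
  have "\<exists>l. socle_series G l = carrier G"
  proof (rule ccontr)
    assume "\<nexists>l. socle_series G l = carrier G"
    then have ps: "socle_series G i \<subset> socle_series G (Suc i)" for i
      using socle_series_psubset[OF assms] by blast
    have sub: "socle_series G i \<subseteq> carrier G" for i
      using normal_imp_subgroup[OF socle_series_normal[OF assms(1)]] subgroup.subset by blast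
    have "i \<le> card (socle_series G i)" for i
    proof (induction i)
      case (Suc i)
      have "card (socle_series G i) < card (socle_series G (Suc i))"
        using ps sub assms(2) by (meson finite_subset psubset_card_mono)
      then show ?case using Suc by linarith
    qed simp
    from this[of "Suc (card (carrier G))"] show False
      using card_mono[OF assms(2) sub[of "Suc (card (carrier G))"]] by linarith
  qed
  then show ?thesis unfolding socle_length_def by (rule LeastI_ex)
qed

end

theory Submission
  imports Defs
begin

text \<open>
  The socle is compatible with both operations: a surjection maps the socle of its source into
  the socle of its target, and \<open>socle G \<inter> N \<subseteq> socle N\<close> for a normal subgroup \<open>N\<close>. The latter
  uses complete reducibility: with \<open>L\<close> normal in \<open>G\<close> and maximal subject to
  \<open>L \<inter> socle N = 1\<close>, one has \<open>socle G \<subseteq> (socle N) L\<close>, while \<open>L \<inter> N = 1\<close>, since a minimal normal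
  subgroup of \<open>G\<close> inside \<open>N\<close> lies in \<open>socle N\<close>. By induction on \<open>i\<close> both facts propagate to the
  terms of the socle series, because \<open>N / (N \<inter> V\<^sub>i(G))\<close> maps onto \<open>N / V\<^sub>i(N)\<close>.
\<close>

section \<open>The socle under surjections\<close>

lemma (in group_hom) normal_vimage:
  assumes "M \<lhd> H" shows "{x \<in> carrier G. h x \<in> M} \<lhd> G"
proof -
  interpret M: normal M H by fact
  show ?thesis
    unfolding G.normal_inv_iff by (auto intro!: subgroup.intro M.inv_op_closed2)
qed

lemma (in group_hom) normal_image:
  assumes "h ` carrier G = carrier H" "M \<lhd> G" shows "h ` M \<lhd> H"
  using normal.surj_hom_normal_subgroup[OF assms(2) group_hom_axioms assms(1)] .

text \<open>Stated for a pair of surjections with nested kernels, that is, for the induced map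
  \<open>A \<rightarrow> B\<close>, so that no quotient group has to be formed.\<close>

lemma socle_surj:
  assumes p: "group_hom L A p" "p ` carrier L = carrier A"
    and q: "group_hom L B q" "q ` carrier L = carrier B"
    and ker: "\<And>x. x \<in> carrier L \<Longrightarrow> p x = \<one>\<^bsub>A\<^esub> \<Longrightarrow> q x = \<one>\<^bsub>B\<^esub>"
    and x: "x \<in> carrier L" "p x \<in> socle A"
  shows "q x \<in> socle B"
proof -
  interpret p: group_hom L A p by fact
  interpret q: group_hom L B q by fact
  interpret S: normal "socle B" B by (rule socle_normal) (rule q.H.group_axioms)
  \<comment> \<open>The kernel condition makes \<open>q\<close> factor through \<open>p\<close>, so
    the induced map from \<open>A\<close> to \<open>B\<close> is well defined.\<close>
  have ker_eq: "q x = q y" if "x \<in> carrier L" "y \<in> carrier L" "p x = p y" for x y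
  proof -
    have "p (x \<otimes>\<^bsub>L\<^esub> inv\<^bsub>L\<^esub> y) = \<one>\<^bsub>A\<^esub>" using that by simp
    then have "q (x \<otimes>\<^bsub>L\<^esub> inv\<^bsub>L\<^esub> y) = \<one>\<^bsub>B\<^esub>" using that by (simp add: ker)
    then have "q x \<otimes>\<^bsub>B\<^esub> inv\<^bsub>B\<^esub> q y = \<one>\<^bsub>B\<^esub>" using that by simp
    then show ?thesis using that q.H.inv_equality[of "q x" "inv\<^bsub>B\<^esub> (q y)"] by simp
  qed
  \<comment> \<open>The set on the left is the image of \<open>M\<close> under the induced map. It
    is either trivial or minimal normal in \<open>B\<close>, hence inside the socle in both
    cases.\<close>
  have min: "q ` {x \<in> carrier L. p x \<in> M} \<subseteq> socle B" if M: "minimal_normal M A" for M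
  proof -
    let ?P = "{x \<in> carrier L. p x \<in> M}"
    have MA: "M \<lhd> A" using M by (simp add: minimal_normal_def)
    have nP: "?P \<lhd> L" by (rule p.normal_vimage[OF MA])
    have nQ: "q ` ?P \<lhd> B" by (rule q.normal_image[OF q(2) nP])
    have "K = {\<one>\<^bsub>B\<^esub>} \<or> K = q ` ?P" if K: "K \<lhd> B" "K \<subseteq> q ` ?P" for K
    proof -
      \<comment> \<open>Pulling \<open>K\<close> back into \<open>?P\<close> and pushing the result
        along \<open>p\<close> gives a normal subgroup of \<open>A\<close> inside \<open>M\<close>,
        to which the minimality of \<open>M\<close> applies.\<close>
      let ?R = "{x \<in> carrier L. q x \<in> K} \<inter> ?P"
      have nR: "?R \<lhd> L"
        by (rule p.G.normal_subgroup_intersect[OF q.normal_vimage[OF K(1)] nP])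
      have "p ` ?R \<lhd> A" by (rule p.normal_image[OF p(2) nR])
      then consider "p ` ?R = {\<one>\<^bsub>A\<^esub>}" | "p ` ?R = M"
        using M unfolding minimal_normal_def by blast
      then show ?thesis
      proof cases
        case 1
        \<comment> \<open>Any \<open>x\<close> in \<open>?P\<close> over \<open>k\<close> lies in
          \<open>?R\<close>, so \<open>p x\<close> is trivial here and \<open>ker\<close> makes
          \<open>q x\<close> trivial too.\<close>
        have "k = \<one>\<^bsub>B\<^esub>" if k: "k \<in> K" for k
        proof -
          obtain x where x: "x \<in> ?P" "k = q x" using subsetD[OF K(2) k] by (rule imageE)
          then have "p x \<in> p ` ?R" using k by (intro imageI) simp
          then have "p x = \<one>\<^bsub>A\<^esub>" unfolding 1 by simp
          then show ?thesis using x ker by simp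
        qed
        moreover have "\<one>\<^bsub>B\<^esub> \<in> K"
          using subgroup.one_closed[OF normal_imp_subgroup[OF K(1)]] .
        ultimately show ?thesis by blast
      next
        case 2
        have "q x \<in> K" if "x \<in> ?P" for x
        proof -
          have "p x \<in> p ` ?R" using that 2 by blast
          then obtain y where "y \<in> ?R" "p x = p y" by blast
          then show ?thesis using ker_eq[of x y] that by simp
        qed
        then show ?thesis using K(2) by blast
      qed
    qed
    then have "q ` ?P = {\<one>\<^bsub>B\<^esub>} \<or> minimal_normal (q ` ?P) B"
      using nQ unfolding minimal_normal_def by blast
    then show ?thesis
    proof
      assume "q ` ?P = {\<one>\<^bsub>B\<^esub>}"
      then show ?thesis using S.one_closed by simp
    qed (auto simp: socle_def intro: generate.incl)
  qed
  \<comment> \<open>The induction follows the generation of \<open>a\<close> in \<open>A\<close>, so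
    the claim ranges over all preimages of \<open>a\<close>. For a product, preimages of the two
    factors are chosen and \<open>ker_eq\<close> compares their product with
    \<open>x\<close>.\<close>
  have "\<forall>x\<in>carrier L. p x = a \<longrightarrow> q x \<in> socle B" if "a \<in> socle A" for a
    using that unfolding socle_def[of A]
  proof (induction a rule: generate.induct)
    case one
    then show ?case using ker S.one_closed by auto
  next
    case (incl a)
    then show ?case using min by blast
  next
    case (inv a)
    then obtain M where M: "minimal_normal M A" "a \<in> M" by blast
    then have "inv\<^bsub>A\<^esub> a \<in> M"
      by (auto simp: minimal_normal_def dest: normal_imp_subgroup subgroup.m_inv_closed)
    then show ?case using min[OF M(1)] by (simp add: image_subset_iff)
  next
    case (eng a b)
    have "socle A \<subseteq> carrier A"
      by (intro subgroup.subset normal_imp_subgroup socle_normal p.H.group_axioms)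
    then have "a \<in> p ` carrier L" "b \<in> p ` carrier L"
      using eng.hyps unfolding socle_def p(2) by blast+
    then obtain y z where yz: "y \<in> carrier L" "z \<in> carrier L" "a = p y" "b = p z"
      by (elim imageE)
    show ?case
    proof (intro ballI impI)
      fix x assume "x \<in> carrier L" "p x = a \<otimes>\<^bsub>A\<^esub> b"
      then have "q x = q (y \<otimes>\<^bsub>L\<^esub> z)" using yz by (intro ker_eq) auto
      then show "q x \<in> socle B" using eng.IH yz by simp
    qed
  qed
  then show ?thesis using x by blast
qed

section \<open>Minimal normal subgroups and the socle of a normal subgroup\<close>

lemma minimal_normal_below:
  assumes "finite (carrier G)" "K \<lhd> G" "K \<noteq> {\<one>\<^bsub>G\<^esub>}"
  obtains M where "minimal_normal M G" "M \<subseteq> K"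
proof -
  let ?S = "{M. M \<lhd> G \<and> M \<noteq> {\<one>\<^bsub>G\<^esub>} \<and> M \<subseteq> K}"
  have "?S \<subseteq> Pow (carrier G)"
    by (auto dest!: normal_imp_subgroup dest: subgroup.mem_carrier)
  then have "finite ?S" using assms(1) by (meson finite_Pow_iff finite_subset)
  moreover have "K \<in> ?S" using assms by simp
  ultimately obtain M where "M \<in> ?S" "\<forall>N\<in>?S. N \<subseteq> M \<longrightarrow> M = N"
    using finite_has_minimal[of ?S] by blast
  then show thesis by (intro that[of M]) (auto simp: minimal_normal_def)
qed

lemma minimal_normal_subset_socle: "minimal_normal M G \<Longrightarrow> M \<subseteq> socle G"
  by (auto simp: socle_def intro: generate.incl)

text \<open>Conjugation by an element of \<open>G\<close> is an automorphism of \<open>N\<close>, hence preserves its socle.\<close>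

lemma socle_of_normal_is_normal:
  assumes "group G" "N \<lhd> G"
  shows "socle (G\<lparr>carrier := N\<rparr>) \<lhd> G"
proof -
  interpret G: group G by fact
  interpret N: normal N G by fact
  let ?N = "G\<lparr>carrier := N\<rparr>"
  have gN: "group ?N" by (rule N.subgroup_is_group[OF assms(1)])
  have nS: "socle ?N \<lhd> ?N" by (rule socle_normal[OF gN])
  have sS: "subgroup (socle ?N) G"
    using G.incl_subgroup[OF N.subgroup_axioms normal_imp_subgroup[OF nS]] .
  have sub: "socle ?N \<subseteq> N" using subgroup.subset[OF normal_imp_subgroup[OF nS]] by simp
  show ?thesis
  proof (rule G.normal_invI[OF sS])
    fix x g assume x: "x \<in> socle ?N" and g: "g \<in> carrier G"
    let ?c = "\<lambda>y. g \<otimes>\<^bsub>G\<^esub> y \<otimes>\<^bsub>G\<^esub> inv\<^bsub>G\<^esub> g"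
    have "?c \<in> hom ?N ?N"
    proof (rule homI)
      fix y z assume "y \<in> carrier ?N" "z \<in> carrier ?N"
      then have yz: "y \<in> carrier G" "z \<in> carrier G" using N.subset by auto
      have "inv\<^bsub>G\<^esub> g \<otimes>\<^bsub>G\<^esub> (g \<otimes>\<^bsub>G\<^esub> (z \<otimes>\<^bsub>G\<^esub> inv\<^bsub>G\<^esub> g)) = z \<otimes>\<^bsub>G\<^esub> inv\<^bsub>G\<^esub> g"
        using g yz by (simp flip: G.m_assoc)
      then show "?c (y \<otimes>\<^bsub>?N\<^esub> z) = ?c y \<otimes>\<^bsub>?N\<^esub> ?c z"
        using g yz by (simp add: G.m_assoc)
    qed (use g N.inv_op_closed2 in auto)
    then have hc: "group_hom ?N ?N ?c"
      using gN by (simp add: group_hom_def group_hom_axioms_def)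
    \<comment> \<open>Surjectivity on \<open>N\<close>: the preimage of \<open>y\<close> is its
      conjugate by the inverse of \<open>g\<close>, which normality keeps in
      \<open>N\<close>.\<close>
    have "y \<in> ?c ` N" if y: "y \<in> N" for y
    proof -
      have "y = ?c (inv\<^bsub>G\<^esub> g \<otimes>\<^bsub>G\<^esub> y \<otimes>\<^bsub>G\<^esub> g)"
        using g y G.inv_solve_right[of _ y g] by (simp flip: G.m_assoc) (simp add: G.m_assoc)
      then show ?thesis using N.inv_op_closed1[OF g y] by blast
    qed
    then have surj: "?c ` N = N" using g N.inv_op_closed2 by blast
    \<comment> \<open>With the identity as first surjection, the induced map in
      \<open>socle_surj\<close> is conjugation itself.\<close>
    have hid: "group_hom ?N ?N (\<lambda>y. y)"
      using gN by (simp add: group_hom_def group_hom_axioms_def hom_def)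
    show "?c x \<in> socle ?N"
      by (rule socle_surj[OF hid _ hc]) (use surj x sub g in auto)
  qed
qed

text \<open>\<open>M\<close> need not be minimal normal in \<open>N\<close>, but it contains some
  \<open>R\<close> that is. Hence \<open>M\<close> meets the socle of \<open>N\<close> nontrivially;
  this socle is normal in \<open>G\<close>, so minimality of \<open>M\<close> in \<open>G\<close>
  forces all of \<open>M\<close> into it.\<close>

lemma minimal_normal_subset_socle_of_normal:
  assumes "group G" "finite (carrier G)" "N \<lhd> G" "minimal_normal M G" "M \<subseteq> N"
  shows "M \<subseteq> socle (G\<lparr>carrier := N\<rparr>)"
proof -
  interpret G: group G by fact
  interpret N: normal N G by fact
  let ?N = "G\<lparr>carrier := N\<rparr>"
  have M: "M \<lhd> G" "M \<noteq> {\<one>\<^bsub>G\<^esub>}" using assms(4) by (auto simp: minimal_normal_def)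
  have "M \<lhd> ?N"
    by (rule G.normal_restrict_supergroup[OF N.subgroup_axioms M(1) assms(5)])
  moreover have "finite (carrier ?N)" using assms(2) N.subset by (auto intro: finite_subset)
  ultimately obtain R where R: "minimal_normal R ?N" "R \<subseteq> M"
    using minimal_normal_below[of ?N M] M(2) by auto
  have "R \<noteq> {\<one>\<^bsub>G\<^esub>}" "\<one>\<^bsub>G\<^esub> \<in> R"
    using R(1) by (auto simp: minimal_normal_def dest!: normal_imp_subgroup dest: subgroup.one_closed)
  moreover have "R \<subseteq> M \<inter> socle ?N" using minimal_normal_subset_socle[OF R(1)] R(2) by blast
  ultimately have "M \<inter> socle ?N \<noteq> {\<one>\<^bsub>G\<^esub>}" by blast
  moreover have "M \<inter> socle ?N \<lhd> G"
    by (rule G.normal_subgroup_intersect[OF M(1) socle_of_normal_is_normal[OF assms(1,3)]])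
  ultimately have "M \<inter> socle ?N = M"
    using assms(4) unfolding minimal_normal_def by blast
  then show ?thesis by blast
qed

section \<open>Complete reducibility of the socle\<close>

lemma (in group) subset_set_mult:
  assumes "subgroup A G" "subgroup B G"
  shows "A \<subseteq> A <#> B" "B \<subseteq> A <#> B"
proof -
  show "A \<subseteq> A <#> B"
  proof
    fix a assume "a \<in> A"
    then have "a \<otimes> \<one> \<in> A <#> B"
      using subgroup.one_closed[OF assms(2)] unfolding set_mult_def by blast
    then show "a \<in> A <#> B" using subgroup.mem_carrier[OF assms(1) \<open>a \<in> A\<close>] by simp
  qed
  show "B \<subseteq> A <#> B"
  proof
    fix b assume "b \<in> B"
    then have "\<one> \<otimes> b \<in> A <#> B"
      using subgroup.one_closed[OF assms(1)] unfolding set_mult_def by blast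
    then show "b \<in> A <#> B" using subgroup.mem_carrier[OF assms(2) \<open>b \<in> B\<close>] by simp
  qed
qed

text \<open>\<open>L\<close> is chosen maximal among the normal subgroups meeting \<open>K\<close>
  trivially. A minimal normal \<open>M\<close> outside \<open>K L\<close> would meet
  \<open>K L\<close> trivially, and then \<open>M L\<close> would be a larger candidate.\<close>

lemma socle_subset_set_mult_complement:
  assumes "group G" "finite (carrier G)" "K \<lhd> G"
  obtains L where "L \<lhd> G" "L \<inter> K = {\<one>\<^bsub>G\<^esub>}" "socle G \<subseteq> K <#>\<^bsub>G\<^esub> L"
proof -
  interpret G: group G by fact
  interpret K: normal K G by fact
  let ?S = "{L. L \<lhd> G \<and> L \<inter> K = {\<one>\<^bsub>G\<^esub>}}"
  have "?S \<subseteq> Pow (carrier G)"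
    by (auto dest!: normal_imp_subgroup dest: subgroup.mem_carrier)
  then have "finite ?S" using assms(2) by (meson finite_Pow_iff finite_subset)
  moreover have "{\<one>\<^bsub>G\<^esub>} \<in> ?S" using G.one_is_normal by auto
  ultimately obtain L where "L \<in> ?S" and max: "\<forall>L'\<in>?S. L \<subseteq> L' \<longrightarrow> L = L'"
    using finite_has_maximal[of ?S] by blast
  then have L: "L \<lhd> G" "L \<inter> K = {\<one>\<^bsub>G\<^esub>}" by auto
  interpret L: normal L G by (rule L(1))
  have KL: "K <#>\<^bsub>G\<^esub> L \<lhd> G" by (rule G.normal_subgroup_set_mult_closed[OF assms(3) L(1)])
  have LKL: "L \<subseteq> K <#>\<^bsub>G\<^esub> L"
    by (rule G.subset_set_mult(2)[OF K.subgroup_axioms L.subgroup_axioms])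
  have "M \<subseteq> K <#>\<^bsub>G\<^esub> L" if M: "minimal_normal M G" for M
  proof (rule ccontr)
    assume not_sub: "\<not> M \<subseteq> K <#>\<^bsub>G\<^esub> L"
    have nM: "M \<lhd> G" using M by (simp add: minimal_normal_def)
    interpret M: normal M G by (rule nM)
    have "M \<inter> (K <#>\<^bsub>G\<^esub> L) \<lhd> G" by (rule G.normal_subgroup_intersect[OF nM KL])
    then have triv: "M \<inter> (K <#>\<^bsub>G\<^esub> L) = {\<one>\<^bsub>G\<^esub>}"
      using M not_sub unfolding minimal_normal_def by blast
    have nMxL: "M <#>\<^bsub>G\<^esub> L \<lhd> G" by (rule G.normal_subgroup_set_mult_closed[OF nM L(1)])
    \<comment> \<open>\<open>M L\<close> meets \<open>K\<close> trivially: if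
      \<open>k = m l\<close>, then \<open>m\<close> lies in both \<open>M\<close> and
      \<open>K L\<close>, so \<open>m\<close> is trivial and \<open>k = l\<close> lies in both
      \<open>K\<close> and \<open>L\<close>.\<close>
    have "k = \<one>\<^bsub>G\<^esub>" if k: "k \<in> K" "k \<in> M <#>\<^bsub>G\<^esub> L" for k
    proof -
      obtain m l where ml: "m \<in> M" "l \<in> L" "k = m \<otimes>\<^bsub>G\<^esub> l"
        using k(2) by (auto simp: set_mult_def)
      have "m = k \<otimes>\<^bsub>G\<^esub> inv\<^bsub>G\<^esub> l"
        using ml by (simp add: G.inv_solve_right)
      then have "m \<in> K <#>\<^bsub>G\<^esub> L" using k(1) ml(2) by (auto simp: set_mult_def)
      then have "m = \<one>\<^bsub>G\<^esub>" using triv ml(1) by blast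
      then have "k \<in> L" using ml by simp
      then show ?thesis using k(1) L(2) by blast
    qed
    moreover have "\<one>\<^bsub>G\<^esub> \<in> M <#>\<^bsub>G\<^esub> L"
      using nMxL by (auto dest: normal_imp_subgroup subgroup.one_closed)
    ultimately have "M <#>\<^bsub>G\<^esub> L \<in> ?S" using nMxL K.one_closed by blast
    moreover have "L \<subseteq> M <#>\<^bsub>G\<^esub> L" "M \<subseteq> M <#>\<^bsub>G\<^esub> L"
      by (rule G.subset_set_mult[OF M.subgroup_axioms L.subgroup_axioms])+
    ultimately have "M \<subseteq> L" using max by blast
    then show False using not_sub LKL by blast
  qed
  then have "socle G \<subseteq> K <#>\<^bsub>G\<^esub> L"
    unfolding socle_def
    by (intro G.generate_subgroup_incl[OF _ normal_imp_subgroup[OF KL]]) blast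
  then show thesis using that L by blast
qed

lemma socle_Int_normal_subset:
  assumes "group G" "finite (carrier G)" "N \<lhd> G"
  shows "socle G \<inter> N \<subseteq> socle (G\<lparr>carrier := N\<rparr>)"
proof -
  interpret G: group G by fact
  interpret N: normal N G by fact
  let ?K = "socle (G\<lparr>carrier := N\<rparr>)"
  have nK: "?K \<lhd> G" by (rule socle_of_normal_is_normal[OF assms(1,3)])
  interpret K: normal ?K G by (rule nK)
  have KN: "?K \<subseteq> N"
    using subgroup.subset[OF normal_imp_subgroup[OF socle_normal[OF N.subgroup_is_group[OF assms(1)]]]]
    by simp
  obtain L where L: "L \<lhd> G" "L \<inter> ?K = {\<one>\<^bsub>G\<^esub>}" "socle G \<subseteq> ?K <#>\<^bsub>G\<^esub> L"
    using socle_subset_set_mult_complement[OF assms(1,2) nK] .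
  interpret L: normal L G by (rule L(1))
  \<comment> \<open>Otherwise \<open>L \<inter> N\<close> contains a minimal normal subgroup of
    \<open>G\<close>, which lies in \<open>?K\<close> as well as in \<open>L\<close>.\<close>
  have LN: "L \<inter> N = {\<one>\<^bsub>G\<^esub>}"
  proof (rule ccontr)
    assume "L \<inter> N \<noteq> {\<one>\<^bsub>G\<^esub>}"
    then obtain M where M: "minimal_normal M G" "M \<subseteq> L \<inter> N"
      using minimal_normal_below[OF assms(2) G.normal_subgroup_intersect[OF L(1) assms(3)]] by blast
    then have "M \<subseteq> ?K" using minimal_normal_subset_socle_of_normal[OF assms M(1)] by blast
    then have "M \<subseteq> {\<one>\<^bsub>G\<^esub>}" using M(2) L(2) by blast
    moreover have "\<one>\<^bsub>G\<^esub> \<in> M"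
      using M(1) by (auto simp: minimal_normal_def dest: normal_imp_subgroup subgroup.one_closed)
    ultimately show False using M(1) by (auto simp: minimal_normal_def)
  qed
  show ?thesis
  proof
    fix x assume x: "x \<in> socle G \<inter> N"
    then obtain s l where sl: "s \<in> ?K" "l \<in> L" "x = s \<otimes>\<^bsub>G\<^esub> l"
      using L(3) by (auto simp: set_mult_def)
    \<comment> \<open>The modular law: as \<open>?K\<close> lies in \<open>N\<close>, so does the
      factor \<open>l\<close>, and \<open>L \<inter> N\<close> is trivial.\<close>
    have "l = inv\<^bsub>G\<^esub> s \<otimes>\<^bsub>G\<^esub> x" using sl by (simp add: G.inv_solve_left)
    moreover have "inv\<^bsub>G\<^esub> s \<otimes>\<^bsub>G\<^esub> x \<in> N" using sl(1) KN x by blast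
    ultimately have "l = \<one>\<^bsub>G\<^esub>" using sl(2) LN by blast
    then show "x \<in> ?K" using sl by simp
  qed
qed

section \<open>Passage to the socle series\<close>

lemma group_hom_coset_map:
  assumes "V \<lhd> G"
  shows "group_hom G (G Mod V) (\<lambda>x. V #>\<^bsub>G\<^esub> x)"
    and "(\<lambda>x. V #>\<^bsub>G\<^esub> x) ` carrier G = carrier (G Mod V)"
proof -
  interpret normal V G by fact
  show "group_hom G (G Mod V) (\<lambda>x. V #>\<^bsub>G\<^esub> x)"
    using r_coset_hom_Mod factorgroup_is_group is_group
    by (simp add: group_hom_def group_hom_axioms_def)
  show "(\<lambda>x. V #>\<^bsub>G\<^esub> x) ` carrier G = carrier (G Mod V)" by (simp add: carrier_FactGroup)
qed

lemma coset_eq_one_iff: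
  assumes "V \<lhd> G" "x \<in> carrier G"
  shows "V #>\<^bsub>G\<^esub> x = \<one>\<^bsub>G Mod V\<^esub> \<longleftrightarrow> x \<in> V"
proof -
  interpret normal V G by fact
  show ?thesis using rcos_self[OF assms(2) subgroup_axioms] rcos_const by auto
qed

text \<open>The induction hypothesis says that the kernel of the quotient map
  \<open>G \<rightarrow> G Mod ?V\<close> lies in the kernel of the composite
  \<open>G \<rightarrow> H \<rightarrow> H Mod ?W\<close>. Thus \<open>socle_surj\<close> applies
  and yields the next stage.\<close>

lemma socle_series_epi:
  assumes "group G" "group H" "f \<in> epi G H" "x \<in> socle_series G i"
  shows "f x \<in> socle_series H i"
  using assms(4)
proof (induction i arbitrary: x)
  interpret f: group_hom G H f
    using assms(1-3) by (simp add: epi_def group_hom_def group_hom_axioms_def)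
  case 0
  then show ?case by simp
next
  interpret f: group_hom G H f
    using assms(1-3) by (simp add: epi_def group_hom_def group_hom_axioms_def)
  case (Suc i)
  let ?V = "socle_series G i" and ?W = "socle_series H i"
  have V: "?V \<lhd> G" and W: "?W \<lhd> H" by (rule socle_series_normal; fact)+
  note p = group_hom_coset_map[OF V] and q = group_hom_coset_map[OF W]
  have surj: "f ` carrier G = carrier H" using assms(3) by (simp add: epi_def)
  have qf: "group_hom G (H Mod ?W) (\<lambda>x. ?W #>\<^bsub>H\<^esub> f x)"
    using hom_compose[OF f.homh group_hom.homh[OF q(1)]] assms(1) group_hom.axioms(2)[OF q(1)]
    by (simp add: group_hom_def group_hom_axioms_def comp_def)
  have x: "x \<in> carrier G" "?V #>\<^bsub>G\<^esub> x \<in> socle (G Mod ?V)" using Suc.prems by auto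
  have "?W #>\<^bsub>H\<^esub> f x \<in> socle (H Mod ?W)"
  proof (rule socle_surj[OF p qf _ _ x])
    show "(\<lambda>x. ?W #>\<^bsub>H\<^esub> f x) ` carrier G = carrier (H Mod ?W)"
      using q(2) surj by (simp flip: image_image[of "\<lambda>x. ?W #>\<^bsub>H\<^esub> x" f])
    show "?W #>\<^bsub>H\<^esub> f y = \<one>\<^bsub>H Mod ?W\<^esub>"
      if "y \<in> carrier G" "?V #>\<^bsub>G\<^esub> y = \<one>\<^bsub>G Mod ?V\<^esub>" for y
    proof -
      have "y \<in> ?V" using that coset_eq_one_iff[OF V] by blast
      then show ?thesis using that(1) Suc.IH coset_eq_one_iff[OF W, of "f y"] by simp
    qed
  qed
  then show ?case using x(1) by simp
qed

lemma socle_series_Int_normal_subset: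
  assumes "group G" "finite (carrier G)" "N \<lhd> G"
  shows "socle_series G i \<inter> N \<subseteq> socle_series (G\<lparr>carrier := N\<rparr>) i"
proof (induction i)
  case 0
  then show ?case by simp
next
  case (Suc i)
  let ?N = "G\<lparr>carrier := N\<rparr>"
  let ?V = "socle_series G i" and ?W = "socle_series ?N i"
  let ?p = "\<lambda>x. ?V #>\<^bsub>G\<^esub> x" and ?Q = "G Mod ?V"
  interpret N: normal N G by fact
  have gN: "group ?N" by (rule N.subgroup_is_group[OF assms(1)])
  have V: "?V \<lhd> G" by (rule socle_series_normal[OF assms(1)])
  have W: "?W \<lhd> ?N" by (rule socle_series_normal[OF gN])
  note p = group_hom_coset_map[OF V]
  interpret p: group_hom G ?Q ?p by (rule p(1))
  have nI: "?p ` N \<lhd> ?Q" by (rule p.normal_image[OF p(2) assms(3)])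
  have finQ: "finite (carrier ?Q)" using assms(2) by (simp add: carrier_FactGroup)
  \<comment> \<open>\<open>?I\<close> is the image of \<open>N\<close> in \<open>G Mod ?V\<close>.
    The bound on the socle of a normal subgroup is applied to it there, and then transported to
    \<open>?N Mod ?W\<close>.\<close>
  let ?I = "?Q\<lparr>carrier := ?p ` N\<rparr>"
  have gI: "group ?I"
    by (rule subgroup.subgroup_is_group[OF normal_imp_subgroup[OF nI] p.H.group_axioms])
  have "?p \<in> hom ?N ?I" using p.hom_mult by (auto simp: hom_def)
  then have pN: "group_hom ?N ?I ?p"
    using gN gI by (simp add: group_hom_def group_hom_axioms_def)
  show ?case
  proof
    fix x assume "x \<in> socle_series G (Suc i) \<inter> N"
    then have x: "x \<in> N" "?p x \<in> socle ?Q" by auto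
    have "?p x \<in> socle ?I"
      using socle_Int_normal_subset[OF p.H.group_axioms finQ nI] x by blast
    then have "?W #>\<^bsub>?N\<^esub> x \<in> socle (?N Mod ?W)"
    proof (intro socle_surj[OF pN _ group_hom_coset_map[OF W]])
      \<comment> \<open>The kernel of \<open>N \<rightarrow> ?I\<close> is
        \<open>N \<inter> ?V\<close>, which the induction hypothesis places inside
        \<open>?W\<close>, the kernel of the second map.\<close>
      show "?W #>\<^bsub>?N\<^esub> y = \<one>\<^bsub>?N Mod ?W\<^esub>" if "y \<in> carrier ?N" "?p y = \<one>\<^bsub>?I\<^esub>" for y
      proof -
        have "y \<in> N" using that(1) by simp
        then have "y \<in> ?V" using that(2) coset_eq_one_iff[OF V, of y] N.subset by auto
        then show ?thesis using \<open>y \<in> N\<close> Suc coset_eq_one_iff[OF W, of y] by auto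
      qed
    qed (use x in auto)
    then show "x \<in> socle_series ?N (Suc i)" using x by simp
  qed
qed

theorem proposition5p16:
  shows "(\<forall>(G :: ('a, 'c) monoid_scheme) (H :: ('b, 'd) monoid_scheme) f.
            group G \<and> finite (carrier G) \<and> group H \<and> finite (carrier H) \<and> f \<in> epi G H
              \<longrightarrow> socle_length H \<le> socle_length G)
       \<and> (\<forall>(G :: ('a, 'c) monoid_scheme) N.
            group G \<and> finite (carrier G) \<and> N \<lhd> G
              \<longrightarrow> socle_length (G\<lparr>carrier := N\<rparr>) \<le> socle_length G)"
proof (intro conjI allI impI; elim conjE)
  fix G :: "('a, 'c) monoid_scheme" and H :: "('b, 'd) monoid_scheme" and f
  assume G: "group G" "finite (carrier G)" and H: "group H" and f: "f \<in> epi G H"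
  let ?l = "socle_length G"
  \<comment> \<open>At stage \<open>?l\<close> the series of \<open>G\<close> is all of
    \<open>G\<close>, so its image is all of \<open>H\<close>; the least stage reaching
    \<open>H\<close> is then at most \<open>?l\<close>.\<close>
  have "carrier H = f ` socle_series G ?l"
    using f socle_series_socle_length[OF G] by (simp add: epi_def)
  also have "\<dots> \<subseteq> socle_series H ?l"
    by (intro image_subsetI socle_series_epi[OF G(1) H f])
  finally have "carrier H \<subseteq> socle_series H ?l" .
  then have "socle_series H ?l = carrier H"
    using subgroup.subset[OF normal_imp_subgroup[OF socle_series_normal[OF H]]] by blast
  then show "socle_length H \<le> ?l" unfolding socle_length_def[of H] by (rule Least_le)
next
  fix G :: "('a, 'c) monoid_scheme" and N
  assume G: "group G" "finite (carrier G)" and N: "N \<lhd> G"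
  let ?l = "socle_length G" and ?N = "G\<lparr>carrier := N\<rparr>"
  have sN: "subgroup N G" by (rule normal_imp_subgroup[OF N])
  \<comment> \<open>Intersecting \<open>N\<close> with stage \<open>?l\<close> of the series of
    \<open>G\<close>, which is all of \<open>G\<close>, returns \<open>N\<close>.\<close>
  have "N \<subseteq> socle_series ?N ?l"
    using socle_series_Int_normal_subset[OF G N, of ?l] socle_series_socle_length[OF G]
      subgroup.subset[OF sN] by blast
  then have "socle_series ?N ?l = carrier ?N"
    using subgroup.subset[OF normal_imp_subgroup[OF socle_series_normal[OF
          subgroup.subgroup_is_group[OF sN G(1)]]], of ?l] by auto
  then show "socle_length ?N \<le> ?l" unfolding socle_length_def[of ?N] by (rule Least_le)
qed

end
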